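(* Let $T>0$ and let $F$, $A$, $X_0$ satisfy the standing assumptions (i)-(iii) of the context, with Lipschitz constant $L$. Suppose in addition: (D1) for every $\tau\in(0,\tau^*]$ there exists $K=K_\tau>0$ such that for every $x^u(\cdot)\in S^u(\tau)$ there exists $x^c(\cdot)\in S^c(\tau)$ with $$\max_{t\in[0,\tau]}\|x^u(t)-x^c(t)\|\le K\max_{t\in[0,\tau]}\mathrm{dist}(x^u(t),A(t));$$ (D2) there exists $L_A>0$ with $\mathrm{dist}(A(t_1),A(t_2))\le L_A|t_1-t_2|$ for all $t_1,t_2\in[0,T]$. For every integer $N\ge 1$ let $h_N:=T/N$, and let the blowup size be $\beta_N:=L(P+1)h_N^2$, where $P$ is the constant of the context (the relaxation parameter is $\delta_N=0$). Then for every $\tau\in(0,\tau^*]$ there exists $C>0$ such that for all $N\ge1$ $$\sup_{y_N\in S^c_N(\lfloor\tau/h_N\rfloor,\beta_N,0)}\ \inf_{x(\cdot)\in S^c(\tau)}\ \max_{n=0,\ldots,\lfloor\tau/h_N\rfloor}\|y_{N,n}-x(t_{N,n})\|\le Ch_N .$$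
   Context: Notation: $\|\cdot\|$ is the Euclidean norm on $\mathbb{R}^d$; for a point $a$ and a set $B$, $\mathrm{dist}(a,B)=\inf_{b\in B}\|a-b\|$ (with $\mathrm{dist}(a,\emptyset)=+\infty$); for sets $A,B$, $\mathrm{dist}(A,B)=\sup_{a\in A}\mathrm{dist}(a,B)$; $B_\rho(0)$ is the closed ball of radius $\rho$; $\|F(0,x)\|:=\sup_{v\in F(0,x)}\|v\|$. $W^{1,1}([0,\tau],\mathbb{R}^d)$ is the space of absolutely continuous functions. Standing assumptions: (i) $F:[0,T]\times\mathbb{R}^d\rightrightarrows\mathbb{R}^d$ has nonempty, convex, compact values and there is $L>0$ with $\mathrm{dist}(F(t,x),F(t',x'))\le L|t-t'|+L\|x-x'\|$ for all $t,t'\in[0,T]$, $x,x'\in\mathbb{R}^d$. (ii) $A:[0,T]\rightrightarrows\mathbb{R}^d$ has closed values, and $t_n\to t$, $x_n\in A(t_n)$, $x_n\to x$ imply $x\in A(t)$. (iii) $X_0\subset\mathbb{R}^d$ is compact, and there is $\tau\in(0,T]$ with $S^c(\tau)\ne\emptyset$. Exact solutions: for $\tau\in(0,T]$, $S^u(\tau)$ is the set of $x(\cdot)\in W^{1,1}([0,\tau],\mathbb{R}^d)$ with $\dot x(t)\in F(t,x(t))$ for a.e. $t\in(0,\tau)$ and $x(0)\in X_0$; $S^c(\tau)$ is the set of $x(\cdot)\in S^u(\tau)$ with $x(t)\in A(t)$ for all $t\in[0,\tau]$. Put $\tau^*:=\sup\{\tau\in(0,T]:S^c(\tau)\neq\emptyset\}$.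 Inflated Euler scheme: $h_N=T/N$, $t_{N,n}=nh_N$. For $\beta,\delta\ge0$ and $\nu\in\{0,\ldots,N\}$, $S^c_N(\nu,\beta,\delta)$ is the set of finite sequences $y_N=(y_{N,n})_{n=0}^\nu\subset\mathbb{R}^d$ with $y_{N,n+1}\in y_{N,n}+h_NF(t_{N,n},y_{N,n})+B_{\beta}(0)$ for $0\le n\le\nu-1$, $\mathrm{dist}(y_{N,0},X_0)\le\delta$, and $\mathrm{dist}(y_{N,n},A(t_{N,n}))\le\delta$ for $0\le n\le\nu$. The constants: with blowup sizes $\beta_N\ge0$, $\beta_N/h_N\to0$, and relaxation parameters $\delta_N=0$, $$R:=\max\{1,\tfrac1L\}\,e^{LT}\Big(\sup_{x\in X_0}\|F(0,x)\|+\sup_{N\ge1}\big(\delta_N+\tfrac{\beta_N}{Lh_N}\big)+1\Big)<\infty,\qquad P:=L(T+R)+\sup_{x\in X_0}\|F(0,x)\|.$$ The relations defining $\beta_N$, $R$ and $P$ are understood to hold simultaneously. *)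

theory Defs
  imports "HOL-Analysis.Analysis"
begin

(* The library's infdist and setdist are 0 when a set is empty.  Distances to a set are taken in
   ennreal here, so that the distance to the empty set is infinite; suprema over empty index sets
   are 0. *)

definition point_dist :: "'a::real_normed_vector \<Rightarrow> 'a set \<Rightarrow> ennreal" where
  "point_dist a B = (INF b\<in>B. ennreal (norm (a - b)))"

definition set_excess :: "'a::real_normed_vector set \<Rightarrow> 'a set \<Rightarrow> ennreal" where
  "set_excess A B = (SUP a\<in>A. point_dist a B)"

(* A real supremum: meaningful for nonempty bounded V, in particular for nonempty compact V. *)
definition set_norm :: "'a::real_normed_vector set \<Rightarrow> real" where
  "set_norm V = (SUP v\<in>V. norm v)"

definition absolutely_continuous_fun :: "real \<Rightarrow> real \<Rightarrow> (real \<Rightarrow> 'a::real_normed_vector) \<Rightarrow> bool" where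
  "absolutely_continuous_fun a b x \<longleftrightarrow>
     (\<forall>\<epsilon>>0. \<exists>\<delta>>0. \<forall>(n::nat) (u::nat \<Rightarrow> real) (v::nat \<Rightarrow> real).
        (\<forall>i<n. a \<le> u i \<and> u i \<le> v i \<and> v i \<le> b) \<longrightarrow>
        (\<forall>i<n. \<forall>j<n. i \<noteq> j \<longrightarrow> {u i<..<v i} \<inter> {u j<..<v j} = {}) \<longrightarrow>
        (\<Sum>i<n. v i - u i) < \<delta> \<longrightarrow>
        (\<Sum>i<n. norm (x (v i) - x (u i))) < \<epsilon>)"

definition lipschitz_field ::
    "real \<Rightarrow> real \<Rightarrow> (real \<Rightarrow> 'a::euclidean_space \<Rightarrow> 'a set) \<Rightarrow> bool" where
  "lipschitz_field T L F \<longleftrightarrow>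
     (\<forall>t\<in>{0..T}. \<forall>x. F t x \<noteq> {} \<and> convex (F t x) \<and> compact (F t x)) \<and>
     (\<forall>t\<in>{0..T}. \<forall>t'\<in>{0..T}. \<forall>x x'.
        set_excess (F t x) (F t' x') \<le> ennreal (L * \<bar>t - t'\<bar> + L * norm (x - x')))"

(* The values of A may be empty. *)
definition closed_constraint :: "real \<Rightarrow> (real \<Rightarrow> 'a::euclidean_space set) \<Rightarrow> bool" where
  "closed_constraint T A \<longleftrightarrow>
     (\<forall>t\<in>{0..T}. closed (A t)) \<and>
     (\<forall>(s::nat \<Rightarrow> real) (t::real) (y::nat \<Rightarrow> 'a) (x::'a).
        (\<forall>n. s n \<in> {0..T}) \<longrightarrow> t \<in> {0..T} \<longrightarrow> s \<longlonglongrightarrow> t \<longrightarrow>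
        (\<forall>n. y n \<in> A (s n)) \<longrightarrow> y \<longlonglongrightarrow> x \<longrightarrow> x \<in> A t)"

(* Trajectories are functions on the whole real line of which only the restriction to [0, tau]
   is constrained. *)
definition unconstrained_solutions ::
    "(real \<Rightarrow> 'a::euclidean_space \<Rightarrow> 'a set) \<Rightarrow> 'a set \<Rightarrow> real \<Rightarrow> (real \<Rightarrow> 'a) set" where
  "unconstrained_solutions F X0 \<tau> =
     {x. absolutely_continuous_fun 0 \<tau> x \<and>
         (AE t in lborel. t \<in> {0<..<\<tau>} \<longrightarrow>
            (\<exists>v\<in>F t (x t). (x has_vector_derivative v) (at t))) \<and>
         x 0 \<in> X0}"

definition constrained_solutions ::
    "(real \<Rightarrow> 'a::euclidean_space \<Rightarrow> 'a set) \<Rightarrow> (real \<Rightarrow> 'a set) \<Rightarrow> 'a set \<Rightarrow> real \<Rightarrow> (real \<Rightarrow> 'a) set"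
  where
  "constrained_solutions F A X0 \<tau> =
     {x \<in> unconstrained_solutions F X0 \<tau>. \<forall>t\<in>{0..\<tau>}. x t \<in> A t}"

definition max_time ::
    "real \<Rightarrow> (real \<Rightarrow> 'a::euclidean_space \<Rightarrow> 'a set) \<Rightarrow> (real \<Rightarrow> 'a set) \<Rightarrow> 'a set \<Rightarrow> real" where
  "max_time T F A X0 = Sup {\<tau>\<in>{0<..T}. constrained_solutions F A X0 \<tau> \<noteq> {}}"

definition step :: "real \<Rightarrow> nat \<Rightarrow> real" where
  "step T N = T / real N"

definition grid :: "real \<Rightarrow> nat \<Rightarrow> nat \<Rightarrow> real" where
  "grid T N n = real n * step T N"

(* A finite sequence with indices 0..nu is a function on nat of which only the values at
   0..nu are constrained. *)
definition discrete_solutions ::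
    "real \<Rightarrow> (real \<Rightarrow> 'a::euclidean_space \<Rightarrow> 'a set) \<Rightarrow> (real \<Rightarrow> 'a set) \<Rightarrow> 'a set \<Rightarrow>
     nat \<Rightarrow> nat \<Rightarrow> real \<Rightarrow> real \<Rightarrow> (nat \<Rightarrow> 'a) set" where
  "discrete_solutions T F A X0 N \<nu> \<beta> \<delta> =
     {y. (\<forall>n<\<nu>. y (Suc n) \<in>
            {y n + step T N *\<^sub>R v + b | v b. v \<in> F (grid T N n) (y n) \<and> b \<in> cball 0 \<beta>}) \<and>
         point_dist (y 0) X0 \<le> ennreal \<delta> \<and>
         (\<forall>n\<le>\<nu>. point_dist (y n) (A (grid T N n)) \<le> ennreal \<delta>)}"

(* The constants R and P.  The suprema are real suprema; they are finite when X0 is nonempty and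
   compact, F is a lipschitz_field and the sequence in the second supremum is bounded. *)

definition initial_speed :: "(real \<Rightarrow> 'a::euclidean_space \<Rightarrow> 'a set) \<Rightarrow> 'a set \<Rightarrow> real" where
  "initial_speed F X0 = (SUP x\<in>X0. set_norm (F 0 x))"

definition bound_R ::
    "real \<Rightarrow> real \<Rightarrow> (real \<Rightarrow> 'a::euclidean_space \<Rightarrow> 'a set) \<Rightarrow> 'a set \<Rightarrow>
     (nat \<Rightarrow> real) \<Rightarrow> (nat \<Rightarrow> real) \<Rightarrow> real" where
  "bound_R T L F X0 \<beta> \<delta> =
     max 1 (1 / L) * exp (L * T) *
     (initial_speed F X0 + (SUP N\<in>{1..}. \<delta> N + \<beta> N / (L * step T N)) + 1)"

definition bound_P ::
    "real \<Rightarrow> real \<Rightarrow> (real \<Rightarrow> 'a::euclidean_space \<Rightarrow> 'a set) \<Rightarrow> 'a set \<Rightarrow> real \<Rightarrow> real" where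
  "bound_P T L F X0 R = L * (T + R) + initial_speed F X0"

end

(* A discrete trajectory is interpolated by a piecewise affine y whose velocity w is within O(h) of
   F(t, y(t)), because the blowup contributes beta_N / h = O(h).  Filippov's theorem then gives an
   exact unconstrained solution within O(h) of y, whose distance to A is O(h) by (D2), and (D1)
   replaces it by a constrained one.

   Since the values of F are convex, Filippov's theorem needs no measurable selection: the metric
   projection onto F(t, x) depends continuously on t, x and the projected point.  Hence the iteration
     v_(k+1)(t) = projection of v_k(t) onto F(t, x_k(t)),   x_k(t) = y_0 + int_0^t v_k,   v_0 = w,
   stays within functions that are continuous off the grid, and
   |v_(k+1)(t) - v_k(t)| <= eps (L t)^k / k! makes it converge uniformly.

   The bound on w, uniform in N, comes from the linear growth of F and a discrete Gronwall
   inequality. *)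
theory Submission
  imports Defs
begin

section \<open>Metric projections onto a Lipschitz set-valued map\<close>

text \<open>A finite bound excludes \<open>B = {}\<close>, where the infimum is infinite; in a
  closed nonempty set the infimum is attained at the closest point. This turns
  \<open>ennreal\<close> distance bounds into real witnesses.\<close>

lemma point_dist_le_imp_ex:
  fixes a :: "'a::euclidean_space"
  assumes "closed B" "r \<ge> 0" "point_dist a B \<le> ennreal r"
  shows "\<exists>b\<in>B. norm (a - b) \<le> r"
proof
  have "B \<noteq> {}"
    using assms(3) by (auto simp: point_dist_def top_unique)
  then show "closest_point B a \<in> B"
    using assms by (simp add: closest_point_in_set)
  have "ennreal (norm (a - closest_point B a)) \<le> point_dist a B"
    unfolding point_dist_def
    using closest_point_le[OF assms(1)] by (intro INF_greatest ennreal_leI) (simp add: dist_norm)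
  then show "norm (a - closest_point B a) \<le> r"
    using assms by (meson ennreal_le_iff order_trans)
qed

lemma lipschitz_field_ex_near:
  fixes F :: "real \<Rightarrow> 'a::euclidean_space \<Rightarrow> 'a set"
  assumes F: "lipschitz_field T L F" and "L \<ge> 0" and t: "t \<in> {0..T}" "t' \<in> {0..T}"
    and a: "a \<in> F t x"
  shows "\<exists>b\<in>F t' x'. norm (a - b) \<le> L * \<bar>t - t'\<bar> + L * norm (x - x')"
proof (rule point_dist_le_imp_ex)
  show "closed (F t' x')"
    using F t by (auto simp: lipschitz_field_def compact_imp_closed)
  have "point_dist a (F t' x') \<le> set_excess (F t x) (F t' x')"
    unfolding set_excess_def using a by (rule SUP_upper)
  also have "\<dots> \<le> ennreal (L * \<bar>t - t'\<bar> + L * norm (x - x'))"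
    using F t by (auto simp: lipschitz_field_def)
  finally show "point_dist a (F t' x') \<le> ennreal (L * \<bar>t - t'\<bar> + L * norm (x - x'))" .
qed (use \<open>L \<ge> 0\<close> in auto)

text \<open>Each projection satisfies its variational inequality, which is tested with a point of
  its own set close to the other projection; adding the two gives the estimate. The projections
  differ only by the order of the square root of \<open>d\<close>, which is enough for
  continuity.\<close>

lemma closest_point_diff_sets:
  fixes a :: "'a::euclidean_space"
  assumes A: "convex A" "closed A" "A \<noteq> {}" and B: "convex B" "closed B" "B \<noteq> {}"
    and AB: "\<And>x. x \<in> A \<Longrightarrow> \<exists>y\<in>B. norm (x - y) \<le> d"
    and BA: "\<And>y. y \<in> B \<Longrightarrow> \<exists>x\<in>A. norm (y - x) \<le> d"
  shows "(norm (closest_point A a - closest_point B a))\<^sup>2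
    \<le> d * (norm (a - closest_point A a) + norm (a - closest_point B a))"
proof -
  define p q where "p = closest_point A a" and "q = closest_point B a"
  \<comment> \<open>The point \<open>q\<close> may lie outside \<open>A\<close>. The obtuse-angle
    inequality is applied to \<open>q'\<close> in \<open>A\<close>, and moving from
    \<open>q'\<close> to \<open>q\<close> costs at most \<open>d * norm (a - p)\<close>.\<close>
  have variational: "(a - p) \<bullet> (q - p) \<le> d * norm (a - p)"
    if "convex A" "closed A" "q' \<in> A" "norm (q - q') \<le> d" "p = closest_point A a"
    for A p q and q' :: 'a
  proof -
    have "(a - p) \<bullet> (q' - p) \<le> 0"
      using that closest_point_dot by blast
    moreover have "(a - p) \<bullet> (q - q') \<le> norm (a - p) * d"
      using that norm_cauchy_schwarz[of "a - p" "q - q'"]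
      by (meson mult_left_mono norm_ge_zero order_trans)
    ultimately show ?thesis
      by (simp add: inner_diff_right mult.commute)
  qed
  obtain q' where "q' \<in> A" "norm (q - q') \<le> d"
    using BA B q_def closest_point_in_set by metis
  then have 1: "(a - p) \<bullet> (q - p) \<le> d * norm (a - p)"
    using variational A p_def by blast
  obtain p' where "p' \<in> B" "norm (p - p') \<le> d"
    using AB A p_def closest_point_in_set by metis
  then have 2: "(a - q) \<bullet> (p - q) \<le> d * norm (a - q)"
    using variational B q_def by blast
  have "(norm (p - q))\<^sup>2 = (a - p) \<bullet> (q - p) + (a - q) \<bullet> (p - q)"
    by (simp add: power2_norm_eq_inner inner_diff inner_commute)
  also have "\<dots> \<le> d * (norm (a - p) + norm (a - q))"
    using 1 2 by (simp add: distrib_left)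
  finally show ?thesis
    by (simp add: p_def q_def)
qed

text \<open>The change from \<open>s\<close> to \<open>t\<close> is split at the projection of
  \<open>w s\<close> onto \<open>F t (x t)\<close>: the change of the projected point is controlled
  by nonexpansiveness, the change of the set by \<open>closest_point_diff_sets\<close>.\<close>

lemma continuous_on_closest_point_lipschitz_field:
  fixes F :: "real \<Rightarrow> 'a::euclidean_space \<Rightarrow> 'a set"
  assumes F: "lipschitz_field T L F" and "L \<ge> 0" and D: "D \<subseteq> {0..T}"
    and x: "continuous_on D x" and w: "continuous_on D w"
  shows "continuous_on D (\<lambda>t. closest_point (F t (x t)) (w t))"
  unfolding continuous_on_def
proof
  fix s assume s: "s \<in> D"
  let ?G = "\<lambda>t. F t (x t)"
  let ?f = "\<lambda>t. closest_point (?G t) (w t)"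
  define m where "m = norm (w s - ?f s)"
  define d where "d t = L * \<bar>t - s\<bar> + L * norm (x t - x s)" for t
  \<comment> \<open>The factor \<open>2 * m + d t\<close> bounds the sum of the distances from
    \<open>w s\<close> to the two sets: \<open>m\<close> for the set at \<open>s\<close>, and at
    most \<open>m + d t\<close> for the set at \<open>t\<close>, which has a point within
    \<open>d t\<close> of the projection at \<open>s\<close>.\<close>
  define e where "e t = norm (w t - w s) + sqrt (d t * (2 * m + d t))" for t
  have lims: "(x \<longlongrightarrow> x s) (at s within D)" "(w \<longlongrightarrow> w s) (at s within D)"
    using x w s by (auto simp: continuous_on_def)
  have "(e \<longlongrightarrow> norm (w s - w s) + sqrt ((L * \<bar>s - s\<bar> + L * norm (x s - x s)) *
      (2 * m + (L * \<bar>s - s\<bar> + L * norm (x s - x s))))) (at s within D)"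
    unfolding e_def d_def by (intro tendsto_intros lims)
  then have e0: "(e \<longlongrightarrow> 0) (at s within D)"
    by simp
  have bound: "norm (?f t - ?f s) \<le> e t" if t: "t \<in> D" for t
  proof -
    have st: "s \<in> {0..T}" "t \<in> {0..T}"
      using s t D by auto
    then have G: "convex (?G t)" "closed (?G t)" "?G t \<noteq> {}" "convex (?G s)" "closed (?G s)" "?G s \<noteq> {}"
      using F by (auto simp: lipschitz_field_def compact_imp_closed)
    have d: "d t \<ge> 0"
      using \<open>L \<ge> 0\<close> by (simp add: d_def)
    have near: "\<exists>b\<in>?G s. norm (a - b) \<le> d t" if "a \<in> ?G t" for a
      unfolding d_def by (rule lipschitz_field_ex_near[OF F \<open>L \<ge> 0\<close> st(2,1) that])
    have near': "\<exists>b\<in>?G t. norm (a - b) \<le> d t" if "a \<in> ?G s" for a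
      using lipschitz_field_ex_near[OF F \<open>L \<ge> 0\<close> st that, of "x t"]
      by (simp add: d_def norm_minus_commute abs_minus_commute)
    define q where "q = closest_point (?G t) (w s)"
    obtain b where b: "b \<in> ?G t" "norm (?f s - b) \<le> d t"
      using near' G closest_point_in_set by metis
    have "norm (w s - q) \<le> norm (w s - b)"
      using closest_point_le[OF G(2) b(1)] by (simp add: q_def dist_norm)
    also have "\<dots> \<le> m + d t"
      using b(2) norm_triangle_ineq[of "w s - ?f s" "?f s - b"] by (simp add: m_def)
    finally have q: "norm (w s - q) \<le> m + d t" .
    have "(norm (q - ?f s))\<^sup>2 \<le> d t * (norm (w s - q) + m)"
      unfolding q_def m_def by (rule closest_point_diff_sets) (use G near near' in auto)
    also have "\<dots> \<le> d t * (2 * m + d t)"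
      using q d by (intro mult_left_mono) auto
    finally have "norm (q - ?f s) \<le> sqrt (d t * (2 * m + d t))"
      by (rule real_le_rsqrt)
    moreover have "norm (?f t - q) \<le> norm (w t - w s)"
      using closest_point_lipschitz[OF G(1-3), of "w t" "w s"] by (simp add: q_def dist_norm)
    ultimately show ?thesis
      using norm_triangle_ineq[of "?f t - q" "q - ?f s"] by (simp add: e_def)
  qed
  have "((\<lambda>t. ?f t - ?f s) \<longlongrightarrow> 0) (at s within D)"
    using e0 by (rule Lim_null_comparison[rotated]) (simp add: eventually_at_filter bound)
  then show "(?f \<longlongrightarrow> ?f s) (at s within D)"
    by (rule LIM_zero_cancel)
qed

section \<open>Filippov's theorem\<close>

lemma integrable_on_bounded_continuous_off_finite:
  fixes f :: "real \<Rightarrow> 'a::euclidean_space"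
  assumes "finite S" and f: "continuous_on ({a..b} - S) f"
    and bound: "\<And>t. t \<in> {a..b} \<Longrightarrow> norm (f t) \<le> M"
  shows "f integrable_on {a..b}"
proof -
  have neg: "negligible S"
    using \<open>finite S\<close> by (rule negligible_finite)
  have lmeas: "{a..b} - S \<in> sets lebesgue"
    using \<open>finite S\<close> by (simp add: finite_imp_closed borel_closed sets.Diff)
  have "negligible ({a..b} - ({a..b} - S) \<union> (({a..b} - S) - {a..b}))"
    by (rule negligible_subset[OF neg]) blast
  note spike = integrable_spike_set_eq[OF this]
  have const: "(\<lambda>_. M) integrable_on {a..b} - S"
    using integrable_const_ivl spike by blast
  have "f integrable_on {a..b} - S"
    by (rule measurable_bounded_by_integrable_imp_integrable
        [OF continuous_imp_measurable_on_sets_lebesgue[OF f lmeas] const _ lmeas])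
      (use bound in blast)
  then show ?thesis
    using spike by blast
qed

lemma absolutely_continuous_fun_lipschitz:
  assumes lip: "\<And>s t. a \<le> s \<Longrightarrow> s \<le> t \<Longrightarrow> t \<le> b \<Longrightarrow> norm (x t - x s) \<le> M * (t - s)"
    and "M \<ge> 0"
  shows "absolutely_continuous_fun a b x"
  unfolding absolutely_continuous_fun_def
proof (intro allI impI)
  fix \<epsilon> :: real assume "\<epsilon> > 0"
  show "\<exists>\<delta>>0. \<forall>(n::nat) u v. (\<forall>i<n. a \<le> u i \<and> u i \<le> v i \<and> v i \<le> b) \<longrightarrow>
        (\<forall>i<n. \<forall>j<n. i \<noteq> j \<longrightarrow> {u i<..<v i} \<inter> {u j<..<v j} = {}) \<longrightarrow>
        (\<Sum>i<n. v i - u i) < \<delta> \<longrightarrow> (\<Sum>i<n. norm (x (v i) - x (u i))) < \<epsilon>"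
  \<comment> \<open>Dividing by \<open>M + 1\<close> instead of \<open>M\<close> keeps the witness
    meaningful for \<open>M = 0\<close>.\<close>
  proof (intro exI[of _ "\<epsilon> / (M + 1)"] conjI allI impI)
    show "\<epsilon> / (M + 1) > 0"
      using \<open>\<epsilon> > 0\<close> \<open>M \<ge> 0\<close> by simp
    fix n :: nat and u v
    assume uv: "\<forall>i<n. a \<le> u i \<and> u i \<le> v i \<and> v i \<le> b"
      and small: "(\<Sum>i<n. v i - u i) < \<epsilon> / (M + 1)"
    have nonneg: "0 \<le> (\<Sum>i<n. v i - u i)"
      using uv by (intro sum_nonneg) auto
    have "(\<Sum>i<n. norm (x (v i) - x (u i))) \<le> (\<Sum>i<n. M * (v i - u i))"
      using uv by (intro sum_mono lip) auto
    also have "\<dots> = M * (\<Sum>i<n. v i - u i)"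
      by (simp add: sum_distrib_left)
    also have "\<dots> \<le> (M + 1) * (\<Sum>i<n. v i - u i)"
      using nonneg by (simp add: distrib_right)
    also have "\<dots> < \<epsilon>"
      using small \<open>M \<ge> 0\<close> by (simp add: pos_less_divide_eq mult.commute)
    finally show "(\<Sum>i<n. norm (x (v i) - x (u i))) < \<epsilon>" .
  qed
qed

section \<open>Convergence of the projected iteration\<close>

lemma has_integral_exp_series_term:
  fixes c L t :: real
  assumes "L \<noteq> 0" "t \<ge> 0"
  shows "((\<lambda>s. c * ((L * s) ^ k / fact k)) has_integral c * ((L * t) ^ Suc k / fact (Suc k)) / L) {0..t}"
proof -
  have "((\<lambda>s. c * ((L * s) ^ Suc k / fact (Suc k)) / L) has_vector_derivative
      c * ((L * s) ^ k / fact k)) (at s within {0..t})" for s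
  proof -
    have "((\<lambda>s. c * ((L * s) ^ Suc k / fact (Suc k)) / L) has_real_derivative
        c * (real (Suc k) * (L * s) ^ k * L / fact (Suc k)) / L) (at s within {0..t})"
      by (intro derivative_eq_intros refl) (use assms in \<open>auto simp: mult_ac\<close>)
    moreover have "c * (real (Suc k) * (L * s) ^ k * L / fact (Suc k)) / L = c * ((L * s) ^ k / fact k)"
      using assms by (simp add: divide_simps)
    ultimately show ?thesis
      by (simp add: has_real_derivative_iff_has_vector_derivative)
  qed
  from fundamental_theorem_of_calculus[OF assms(2) this] show ?thesis
    by simp
qed

lemma norm_integral_diff_le:
  fixes f g :: "real \<Rightarrow> 'a::euclidean_space"
  assumes "f integrable_on {0..\<tau>}" "g integrable_on {0..\<tau>}" "t \<in> {0..\<tau>}"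
    and "(e has_integral I) {0..t}"
    and "\<And>s. s \<in> {0..\<tau>} \<Longrightarrow> norm (f s - g s) \<le> e s"
  shows "norm (integral {0..t} f - integral {0..t} g) \<le> I"
proof -
  have int: "f integrable_on {0..t}" "g integrable_on {0..t}"
    using assms by (auto intro: integrable_subinterval_real)
  have "norm (integral {0..t} (\<lambda>s. f s - g s)) \<le> integral {0..t} e"
    using assms int
    by (intro Henstock_Kurzweil_Integration.integral_norm_bound_integral integrable_diff) auto
  then show ?thesis
    using assms(4) int by (simp add: Henstock_Kurzweil_Integration.integral_diff integral_unique)
qed

text \<open>The result is a velocity, not a curve: the projections are taken at every time and
  converge uniformly, so the inclusion holds everywhere on \<open>{0..\<tau>}\<close>, and
  \<open>v\<close> is continuous off the same finite set \<open>S\<close> as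
  \<open>w\<close>.\<close>

lemma filippov_approximation:
  fixes F :: "real \<Rightarrow> 'a::euclidean_space \<Rightarrow> 'a set"
  assumes F: "lipschitz_field T L F" and L: "L > 0" and \<tau>: "0 \<le> \<tau>" "\<tau> \<le> T"
    and S: "finite S" and w: "continuous_on ({0..\<tau>} - S) w"
    and w_bound: "\<And>t. t \<in> {0..\<tau>} \<Longrightarrow> norm (w t) \<le> W"
    and near: "\<And>t. t \<in> {0..\<tau>} \<Longrightarrow> \<exists>b\<in>F t (y0 + integral {0..t} w). norm (w t - b) \<le> \<epsilon>"
  obtains v where "continuous_on ({0..\<tau>} - S) v"
    and "\<And>t. t \<in> {0..\<tau>} \<Longrightarrow> v t \<in> F t (y0 + integral {0..t} v)"
    and "\<And>t. t \<in> {0..\<tau>} \<Longrightarrow> norm (v t - w t) \<le> \<epsilon> * exp (L * \<tau>)"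
proof -
  define v where "v = rec_nat w (\<lambda>k u t. closest_point (F t (y0 + integral {0..t} u)) (u t))"
  define X where "X k t = y0 + integral {0..t} (v k)" for k t
  have v_0: "v 0 = w" and v_Suc: "v (Suc k) t = closest_point (F t (X k t)) (v k t)" for k t
    by (auto simp: v_def X_def)
  have F_closed: "closed (F t x)" and F_ne: "F t x \<noteq> {}" if "t \<in> {0..\<tau>}" for t x
    using F that \<tau> by (auto simp: lipschitz_field_def compact_imp_closed)
  have v_in: "v (Suc k) t \<in> F t (X k t)" if "t \<in> {0..\<tau>}" for k t
    using closest_point_in_set F_closed F_ne that by (metis v_Suc)
  have F_near: "\<exists>b\<in>F t x'. norm (a - b) \<le> L * norm (x - x')" if "t \<in> {0..\<tau>}" "a \<in> F t x" for t a x x'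
    using lipschitz_field_ex_near[OF F _ _ _ that(2), of t x'] that(1) \<tau> L by simp
  have v_Suc_near: "norm (v (Suc k) t - v k t) \<le> r"
    if "t \<in> {0..\<tau>}" "b \<in> F t (X k t)" "norm (v k t - b) \<le> r" for k t b r
    using closest_point_le[OF F_closed[OF that(1)] that(2), of "v k t"] that(3)
    by (simp add: v_Suc dist_norm norm_minus_commute)
  have \<epsilon>: "\<epsilon> \<ge> 0"
    using near[of 0] \<tau> norm_ge_zero by (metis atLeastAtMost_iff order.refl order_trans)
  have int: "u integrable_on {0..\<tau>}"
    if "continuous_on ({0..\<tau>} - S) u" "\<forall>t\<in>{0..\<tau>}. norm (u t) \<le> M" for u :: "real \<Rightarrow> 'a" and M
    using integrable_on_bounded_continuous_off_finite[OF S] that by blast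
  have mono: "\<epsilon> * ((L * t) ^ k / fact k) \<le> \<epsilon> * ((L * \<tau>) ^ k / fact k)" if "t \<in> {0..\<tau>}" for t k
    using that L \<epsilon> by (intro mult_left_mono divide_right_mono power_mono) auto
  \<comment> \<open>Continuity and boundedness are carried along with the increment estimate because
    they make \<open>v k\<close> integrable, hence \<open>X k\<close> continuous. The bound
    \<open>M\<close> may depend on \<open>k\<close> here.\<close>
  have iterates: "continuous_on ({0..\<tau>} - S) (v k) \<and> (\<exists>M. \<forall>t\<in>{0..\<tau>}. norm (v k t) \<le> M) \<and>
      (\<forall>t\<in>{0..\<tau>}. norm (v (Suc k) t - v k t) \<le> \<epsilon> * ((L * t) ^ k / fact k))" for k
  proof (induction k)
    case 0
    \<comment> \<open>\<open>X 0\<close> is the curve driven by \<open>w\<close>, so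
      \<open>near\<close> is exactly the initial increment estimate.\<close>
    have "norm (v (Suc 0) t - v 0 t) \<le> \<epsilon>" if t: "t \<in> {0..\<tau>}" for t
      using near[OF t] v_Suc_near[OF t, of _ 0] by (auto simp: X_def v_0)
    then show ?case
      unfolding v_0 using w w_bound by (intro conjI exI[of _ W]) (simp_all add: v_0)
  next
    case (Suc k)
    then obtain M where M: "\<forall>t\<in>{0..\<tau>}. norm (v k t) \<le> M"
      and cont: "continuous_on ({0..\<tau>} - S) (v k)"
      and diff: "\<And>t. t \<in> {0..\<tau>} \<Longrightarrow> norm (v (Suc k) t - v k t) \<le> \<epsilon> * ((L * t) ^ k / fact k)"
      by blast
    have int_k: "v k integrable_on {0..\<tau>}"
      using int cont M by blast
    have "continuous_on {0..\<tau>} (X k)"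
      unfolding X_def by (intro continuous_intros indefinite_integral_continuous_1 int_k)
    then have cont': "continuous_on ({0..\<tau>} - S) (v (Suc k))"
      unfolding v_Suc using L \<tau>
      by (intro continuous_on_closest_point_lipschitz_field[OF F _ _ _ cont])
        (auto intro: continuous_on_subset)
    have M': "\<forall>t\<in>{0..\<tau>}. norm (v (Suc k) t) \<le> \<epsilon> * ((L * \<tau>) ^ k / fact k) + M"
    proof
      fix t assume t: "t \<in> {0..\<tau>}"
      have "norm (v (Suc k) t - v k t) \<le> \<epsilon> * ((L * \<tau>) ^ k / fact k)" "norm (v k t) \<le> M"
        using diff[OF t] mono[OF t, of k] M t by auto
      then show "norm (v (Suc k) t) \<le> \<epsilon> * ((L * \<tau>) ^ k / fact k) + M"
        using norm_triangle_ineq[of "v (Suc k) t - v k t" "v k t"] by simp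
    qed
    \<comment> \<open>Since \<open>v (Suc k) t\<close> lies in \<open>F t (X k t)\<close>, the set
      \<open>F t (X (Suc k) t)\<close> has a point within
      \<open>L * norm (X k t - X (Suc k) t)\<close> of it, and the projection is no farther. The
      factor \<open>L\<close> cancels the \<open>1 / L\<close> produced by integrating the previous
      bound.\<close>
    have "norm (v (Suc (Suc k)) t - v (Suc k) t) \<le> \<epsilon> * ((L * t) ^ Suc k / fact (Suc k))"
      if t: "t \<in> {0..\<tau>}" for t
    proof -
      have "norm (integral {0..t} (v (Suc k)) - integral {0..t} (v k))
          \<le> \<epsilon> * ((L * t) ^ Suc k / fact (Suc k)) / L"
        using L t by (intro norm_integral_diff_le[OF int[OF cont' M'] int_k t
              has_integral_exp_series_term] diff) auto
      then have "L * norm (X k t - X (Suc k) t) \<le> \<epsilon> * ((L * t) ^ Suc k / fact (Suc k))"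
        using L by (simp only: X_def pos_le_divide_eq norm_minus_commute add_diff_cancel_left mult.commute)
      moreover obtain b where "b \<in> F t (X (Suc k) t)"
        "norm (v (Suc k) t - b) \<le> L * norm (X k t - X (Suc k) t)"
        using F_near[OF t v_in[OF t]] by blast
      ultimately show ?thesis
        using v_Suc_near[OF t] order_trans by blast
    qed
    then show ?case
      using cont' M' by blast
  qed
  then have cont: "continuous_on ({0..\<tau>} - S) (v k)"
    and diff: "\<And>t. t \<in> {0..\<tau>} \<Longrightarrow> norm (v (Suc k) t - v k t) \<le> \<epsilon> * ((L * \<tau>) ^ k / fact k)" for k
    using mono order_trans by blast+
  have int_v: "v k integrable_on {0..\<tau>}" for k
    using iterates[of k] int by blast
  \<comment> \<open>The increments are dominated by an exponential series: its convergence gives the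
    Weierstrass test, its sum the final distance between \<open>u\<close> and
    \<open>w\<close>.\<close>
  have majorant: "(\<lambda>k. \<epsilon> * ((L * \<tau>) ^ k / fact k)) sums (\<epsilon> * exp (L * \<tau>))"
    using exp_converges[of "L * \<tau>"] by (intro sums_mult) (simp add: divide_inverse mult.commute)
  define d where "d t = (\<Sum>k. v (Suc k) t - v k t)" for t
  define u where "u t = w t + d t" for t
  have telescope: "w t + (\<Sum>k<n. v (Suc k) t - v k t) = v n t" for n t
    by (subst sum_lessThan_telescope) (simp add: v_0)
  have "uniform_limit {0..\<tau>} (\<lambda>n t. \<Sum>k<n. v (Suc k) t - v k t) d sequentially"
    unfolding d_def by (rule Weierstrass_m_test[OF diff]) (use majorant in \<open>auto simp: sums_iff\<close>)
  then have "uniform_limit {0..\<tau>} (\<lambda>n t. w t + (\<Sum>k<n. v (Suc k) t - v k t)) u sequentially"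
    unfolding u_def by (intro uniform_limit_add uniform_limit_const)
  then have unif: "uniform_limit {0..\<tau>} v u sequentially"
    by (simp add: telescope)
  have d_bound: "norm (u t - w t) \<le> \<epsilon> * exp (L * \<tau>)" if t: "t \<in> {0..\<tau>}" for t
  proof -
    have "norm (d t) \<le> (\<Sum>k. \<epsilon> * ((L * \<tau>) ^ k / fact k))"
      unfolding d_def using majorant diff[OF t] by (intro norm_suminf_le) (auto simp: sums_iff)
    then show ?thesis
      using majorant by (simp add: u_def sums_iff)
  qed
  have cont_u: "continuous_on ({0..\<tau>} - S) u"
    by (rule uniform_limit_theorem[OF _ uniform_limit_on_subset[OF unif]]) (auto simp: cont)
  have "\<forall>t\<in>{0..\<tau>}. norm (u t) \<le> \<epsilon> * exp (L * \<tau>) + W"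
  proof
    fix t assume "t \<in> {0..\<tau>}"
    then have "norm (u t - w t) \<le> \<epsilon> * exp (L * \<tau>)" "norm (w t) \<le> W"
      using d_bound w_bound by auto
    then show "norm (u t) \<le> \<epsilon> * exp (L * \<tau>) + W"
      using norm_triangle_ineq[of "u t - w t" "w t"] by simp
  qed
  then have int_u: "u integrable_on {0..\<tau>}"
    using int cont_u by blast
  \<comment> \<open>The iterates satisfy \<open>v (Suc k) t \<in> F t (X k t)\<close> with a moving
    argument. Each is replaced by a nearby \<open>b k\<close> in the fixed closed set
    \<open>F t x\<close>; as \<open>X k t\<close> tends to \<open>x\<close>, the points
    \<open>b k\<close> tend to \<open>u t\<close>.\<close>
  have "u t \<in> F t (y0 + integral {0..t} u)" if t: "t \<in> {0..\<tau>}" for t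
  proof -
    define x where "x = y0 + integral {0..t} u"
    have X_lim: "(\<lambda>k. X k t) \<longlonglongrightarrow> x"
      unfolding X_def x_def
    proof (intro tendsto_intros tendstoI)
      fix r :: real assume "r > 0"
      \<comment> \<open>The case \<open>\<tau> = 0\<close> is allowed, hence the shift by one; the
        integral over \<open>{0..t}\<close> then stays strictly below \<open>r\<close>.\<close>
      then have "r / (\<tau> + 1) > 0"
        using \<tau> by simp
      with unif have "\<forall>\<^sub>F k in sequentially. \<forall>s\<in>{0..\<tau>}. dist (v k s) (u s) < r / (\<tau> + 1)"
        by (rule uniform_limitD)
      then show "\<forall>\<^sub>F k in sequentially. dist (integral {0..t} (v k)) (integral {0..t} u) < r"
      proof eventually_elim
        case (elim k)
        have "((\<lambda>_. r / (\<tau> + 1)) has_integral t * (r / (\<tau> + 1))) {0..t}"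
          using t has_integral_const_real[of "r / (\<tau> + 1)" 0 t] by simp
        from norm_integral_diff_le[OF int_v[of k] int_u t this] elim
        have "norm (integral {0..t} (v k) - integral {0..t} u) \<le> t * (r / (\<tau> + 1))"
          by (auto simp: dist_norm less_imp_le)
        also have "\<dots> < (\<tau> + 1) * (r / (\<tau> + 1))"
          using t \<tau> \<open>r > 0\<close> by (intro mult_strict_right_mono) auto
        also have "\<dots> = r"
          using \<tau> by simp
        finally show ?case
          by (simp add: dist_norm)
      qed
    qed
    have v_lim: "(\<lambda>k. v (Suc k) t) \<longlonglongrightarrow> u t"
      using tendsto_uniform_limitI[OF unif t] by (rule LIMSEQ_Suc)
    have "\<forall>k. \<exists>b. b \<in> F t x \<and> norm (v (Suc k) t - b) \<le> L * norm (X k t - x)"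
      using F_near[OF t v_in[OF t]] by blast
    then obtain b where b: "\<And>k. b k \<in> F t x" "\<And>k. norm (v (Suc k) t - b k) \<le> L * norm (X k t - x)"
      by metis
    have "(\<lambda>k. L * norm (X k t - x)) \<longlonglongrightarrow> L * norm (x - x)"
      by (intro tendsto_intros X_lim)
    then have "(\<lambda>k. L * norm (X k t - x)) \<longlonglongrightarrow> 0"
      by simp
    with always_eventually[OF allI[OF b(2)]] have b_lim: "(\<lambda>k. v (Suc k) t - b k) \<longlonglongrightarrow> 0"
      by (rule Lim_null_comparison)
    have "b \<longlonglongrightarrow> u t"
      using tendsto_diff[OF v_lim b_lim] by simp
    then have "u t \<in> F t x"
      using closed_sequentially[OF F_closed[OF t]] b(1) by blast
    then show ?thesis
      by (simp add: x_def)
  qed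
  then show thesis
    using that cont_u d_bound by blast
qed

text \<open>A bounded velocity makes the curve Lipschitz, hence absolutely continuous. At points off
  \<open>S\<close> the velocity is continuous, so the integral is differentiable there, and the
  finite set \<open>S\<close> is null.\<close>

lemma unconstrained_solutions_integral:
  fixes F :: "real \<Rightarrow> 'a::euclidean_space \<Rightarrow> 'a set"
  assumes S: "finite S" and v: "continuous_on ({0..\<tau>} - S) v"
    and v_bound: "\<And>t. t \<in> {0..\<tau>} \<Longrightarrow> norm (v t) \<le> M" and "M \<ge> 0"
    and v_in: "\<And>t. t \<in> {0..\<tau>} \<Longrightarrow> v t \<in> F t (y0 + integral {0..t} v)"
    and y0: "y0 \<in> X0"
  shows "(\<lambda>t. y0 + integral {0..t} v) \<in> unconstrained_solutions F X0 \<tau>"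
proof -
  define x where "x t = y0 + integral {0..t} v" for t
  have int: "v integrable_on {0..\<tau>}"
    by (rule integrable_on_bounded_continuous_off_finite[OF S v v_bound])
  have "norm (x t - x s) \<le> M * (t - s)" if st: "0 \<le> s" "s \<le> t" "t \<le> \<tau>" for s t
  proof -
    have int_t: "v integrable_on {0..t}" and int_st: "v integrable_on {s..t}"
      using st by (auto intro!: integrable_subinterval_real[OF int])
    have "x t - x s = integral {s..t} v"
      using Henstock_Kurzweil_Integration.integral_combine[OF st(1,2) int_t]
      by (auto simp: x_def algebra_simps)
    moreover have "norm (integral {s..t} v) \<le> M * measure lborel {s..t}"
      using v_bound st
      by (intro has_integral_bound_real[OF \<open>M \<ge> 0\<close> finite.emptyI integrable_integral[OF int_st]]) auto
    ultimately show ?thesis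
      using st by simp
  qed
  then have ac: "absolutely_continuous_fun 0 \<tau> x"
    using \<open>M \<ge> 0\<close> by (rule absolutely_continuous_fun_lipschitz)
  have deriv: "(x has_vector_derivative v t) (at t)" if t: "t \<in> {0<..<\<tau>} - S" for t
  proof -
    have t': "t \<in> {0..\<tau>} - S"
      using t by auto
    \<comment> \<open>The integral is first differentiated relative to
      \<open>{0..\<tau>} - S\<close>. Interiority of \<open>t\<close> upgrades this to the two-sided
      derivative that solutions require.\<close>
    have "open ({0<..<\<tau>} - S)"
      using S by (intro open_Diff finite_imp_closed) auto
    then have interior: "t \<in> interior ({0..\<tau>} - S)"
      by (rule interiorI[OF _ t]) auto
    have "((\<lambda>t. integral {0..t} v) has_vector_derivative v t) (at t within ({0..\<tau>} - S))"
      using v t' by (intro integral_has_vector_derivative_continuous_at int S)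
        (auto simp: continuous_on_eq_continuous_within)
    then have "((\<lambda>t. integral {0..t} v) has_vector_derivative v t) (at t)"
      unfolding at_within_interior[OF interior] .
    then have "((\<lambda>t. y0 + integral {0..t} v) has_vector_derivative 0 + v t) (at t)"
      by (intro has_vector_derivative_add has_vector_derivative_const)
    then show ?thesis
      by (simp add: x_def[abs_def])
  qed
  have "AE t in lborel. t \<notin> S"
    using finite_imp_null_set_lborel[OF S] by (rule AE_not_in)
  then have "AE t in lborel. t \<in> {0<..<\<tau>} \<longrightarrow> (\<exists>v\<in>F t (x t). (x has_vector_derivative v) (at t))"
  proof eventually_elim
    case (elim t)
    then show ?case
      using deriv[of t] v_in[of t] by (auto simp: x_def)
  qed
  with ac y0 show ?thesis
    by (simp add: unconstrained_solutions_def x_def[abs_def])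
qed

section \<open>Euler polygons\<close>

lemma nat_floor_divide_eq:
  fixes h t :: real
  assumes "h > 0" "real n * h \<le> t" "t < real (Suc n) * h"
  shows "nat \<lfloor>t / h\<rfloor> = n"
proof -
  have "\<lfloor>t / h\<rfloor> = int n"
    using assms by (simp add: floor_eq_iff pos_le_divide_eq pos_divide_less_eq add.commute)
  then show ?thesis
    by simp
qed

lemma nat_floor_divide_bounds:
  fixes h t :: real
  assumes "h > 0" "t \<ge> 0"
  shows "real (nat \<lfloor>t / h\<rfloor>) * h \<le> t" "t < real (Suc (nat \<lfloor>t / h\<rfloor>)) * h"
proof -
  have "real (nat \<lfloor>t / h\<rfloor>) = of_int \<lfloor>t / h\<rfloor>"
    using assms by simp
  then have "real (nat \<lfloor>t / h\<rfloor>) \<le> t / h" "t / h < real (Suc (nat \<lfloor>t / h\<rfloor>))"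
    by linarith+
  then show "real (nat \<lfloor>t / h\<rfloor>) * h \<le> t" "t < real (Suc (nat \<lfloor>t / h\<rfloor>)) * h"
    using assms by (simp_all only: pos_le_divide_eq pos_divide_less_eq)
qed

text \<open>Induction over the cells, each of which adds one Euler increment. The recursion is
  assumed only below \<open>\<nu>\<close>, yet \<open>n = \<nu>\<close> is covered:
  \<open>u \<nu>\<close> drives the incomplete last cell.\<close>

lemma has_integral_euler_velocity:
  fixes y u :: "nat \<Rightarrow> 'a::banach"
  assumes h: "h > 0" and y: "\<And>n. n < \<nu> \<Longrightarrow> y (Suc n) = y n + h *\<^sub>R u n"
    and n: "n \<le> \<nu>" and t: "real n * h \<le> t" "t \<le> real (Suc n) * h"
  shows "((\<lambda>t. u (nat \<lfloor>t / h\<rfloor>)) has_integral (y n - y 0 + (t - real n * h) *\<^sub>R u n)) {0..t}"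
proof -
  let ?w = "\<lambda>t. u (nat \<lfloor>t / h\<rfloor>)"
  have piece: "(?w has_integral (t - real n * h) *\<^sub>R u n) {real n * h..t}"
    if t: "real n * h \<le> t" "t \<le> real (Suc n) * h" for n t
  \<comment> \<open>At the right end of the closed cell the floor already jumps to the next index;
    this single point is discarded.\<close>
  proof (rule has_integral_spike_finite[of "{real (Suc n) * h}" _ _ "\<lambda>_. u n"])
    fix s assume "s \<in> {real n * h..t} - {real (Suc n) * h}"
    then show "?w s = u n"
      using nat_floor_divide_eq[OF h, of n s] t by auto
  qed (use t has_integral_const_real[of "u n" "real n * h" t] in auto)
  show ?thesis
    using n t
  proof (induction n arbitrary: t)
    case 0
    then show ?case
      using piece[of 0 t] by simp
  next
    case (Suc n)
    let ?s = "real (Suc n) * h"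
    have "(?w has_integral (y n - y 0 + (?s - real n * h) *\<^sub>R u n)) {0..?s}"
      by (rule Suc.IH) (use Suc.prems h in \<open>auto simp: algebra_simps\<close>)
    moreover have "y n - y 0 + (?s - real n * h) *\<^sub>R u n = y (Suc n) - y 0"
      using y[of n] Suc.prems by (simp add: algebra_simps)
    ultimately have "(?w has_integral y (Suc n) - y 0) {0..?s}"
      by (simp only:)
    then show ?case
      using has_integral_combine[OF _ _ _ piece[OF Suc.prems(2,3)]] Suc.prems h by simp
  qed
qed

lemma continuous_on_euler_velocity:
  fixes u :: "nat \<Rightarrow> 'a::topological_space"
  assumes h: "h > 0" and \<tau>: "\<tau> < real (Suc \<nu>) * h"
  shows "continuous_on ({0..\<tau>} - (\<lambda>n. real n * h) ` {..\<nu>}) (\<lambda>t. u (nat \<lfloor>t / h\<rfloor>))"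
  unfolding continuous_on_def
proof
  fix t assume t: "t \<in> {0..\<tau>} - (\<lambda>n. real n * h) ` {..\<nu>}"
  let ?D = "{0..\<tau>} - (\<lambda>n. real n * h) ` {..\<nu>}"
  \<comment> \<open>Off the grid the floor is locally constant. Because \<open>\<tau>\<close> is
    below the node of index \<open>Suc \<nu>\<close>, removing the nodes up to \<open>\<nu>\<close>
    removes every grid point of \<open>{0..\<tau>}\<close>.\<close>
  have "t / h \<notin> \<int>"
  proof
    assume "t / h \<in> \<int>"
    then obtain k where k: "t / h = of_int k"
      by (auto elim: Ints_cases)
    have "k \<ge> 0"
      using t h k by (metis DiffD1 atLeastAtMost_iff divide_nonneg_pos of_int_0_le_iff)
    then have t_eq: "t = real (nat k) * h"
      using k h by (simp add: field_simps)
    then have "real (nat k) * h < real (Suc \<nu>) * h"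
      using t \<tau> by auto
    then have "nat k \<le> \<nu>"
      using h by (metis less_Suc_eq_le mult_less_cancel_right_pos of_nat_less_iff)
    then show False
      using t t_eq by auto
  qed
  moreover have "((\<lambda>s. s / h) \<longlongrightarrow> t / h) (at t within ?D)"
    using h by (intro tendsto_intros) auto
  ultimately have "\<forall>\<^sub>F s in at t within ?D. \<lfloor>s / h\<rfloor> = \<lfloor>t / h\<rfloor>"
    using eventually_floor_eq by blast
  then show "((\<lambda>t. u (nat \<lfloor>t / h\<rfloor>)) \<longlongrightarrow> u (nat \<lfloor>t / h\<rfloor>)) (at t within ?D)"
    by (intro tendsto_eventually) (auto elim: eventually_mono)
qed

section \<open>A priori bounds for discrete trajectories, uniform in the step size\<close>

lemma discrete_gronwall:
  fixes a :: "nat \<Rightarrow> real"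
  assumes "L > 0" "h \<ge> 0" "g \<ge> 0" and a: "\<And>n. n < \<nu> \<Longrightarrow> a (Suc n) \<le> a n + h * (g + L * a n)"
    and "a 0 \<le> B" "B \<ge> 0" and n: "n \<le> \<nu>" "real n * h \<le> T"
  shows "a n \<le> (B + g / L) * exp (L * T)"
proof -
  \<comment> \<open>The shift by \<open>g / L\<close> absorbs the inhomogeneous term, leaving a
    geometric recursion with ratio \<open>1 + h * L\<close>, which is at most
    \<open>exp (h * L)\<close>.\<close>
  have "a n + g / L \<le> (B + g / L) * (1 + h * L) ^ n"
    using n(1)
  proof (induction n)
    case 0
    then show ?case
      using assms by simp
  next
    case (Suc n)
    have "(1 + h * L) * (a n + g / L) = a n + h * (g + L * a n) + g / L"
      using \<open>L > 0\<close> by (simp add: field_simps)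
    then have "a (Suc n) + g / L \<le> (1 + h * L) * (a n + g / L)"
      using a[of n] Suc.prems by simp
    also have "\<dots> \<le> (1 + h * L) * ((B + g / L) * (1 + h * L) ^ n)"
      using Suc assms by (intro mult_left_mono) auto
    finally show ?case
      by (simp add: mult_ac)
  qed
  also have "\<dots> \<le> (B + g / L) * exp (h * L) ^ n"
    using assms by (intro mult_left_mono power_mono exp_ge_add_one_self) auto
  also have "exp (h * L) ^ n = exp (L * (real n * h))"
    by (simp add: exp_of_nat_mult[symmetric] mult_ac)
  also have "(B + g / L) * \<dots> \<le> (B + g / L) * exp (L * T)"
    using assms by (intro mult_left_mono) auto
  finally show ?thesis
    using divide_nonneg_pos[OF \<open>g \<ge> 0\<close> \<open>L > 0\<close>] by linarith
qed

text \<open>With relaxation parameter 0, the distance conditions become membership as soon as the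
  sets are closed.\<close>

lemma discrete_solutionsD:
  fixes F :: "real \<Rightarrow> 'a::euclidean_space \<Rightarrow> 'a set"
  assumes "y \<in> discrete_solutions T F A X0 N \<nu> b 0"
  shows "n < \<nu> \<Longrightarrow> \<exists>v\<in>F (grid T N n) (y n). norm (y (Suc n) - y n - step T N *\<^sub>R v) \<le> b"
    and "closed X0 \<Longrightarrow> y 0 \<in> X0"
    and "n \<le> \<nu> \<Longrightarrow> closed (A (grid T N n)) \<Longrightarrow> y n \<in> A (grid T N n)"
proof -
  have y: "n < \<nu> \<Longrightarrow> y (Suc n) \<in>
      {y n + step T N *\<^sub>R v + e | v e. v \<in> F (grid T N n) (y n) \<and> e \<in> cball 0 b}"
    and y0: "point_dist (y 0) X0 \<le> ennreal 0"
    and yA: "n \<le> \<nu> \<Longrightarrow> point_dist (y n) (A (grid T N n)) \<le> ennreal 0"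
    using assms unfolding discrete_solutions_def by blast+
  show "\<exists>v\<in>F (grid T N n) (y n). norm (y (Suc n) - y n - step T N *\<^sub>R v) \<le> b" if n: "n < \<nu>"
  proof -
    obtain v e where "v \<in> F (grid T N n) (y n)" "norm e \<le> b"
      "y (Suc n) = y n + step T N *\<^sub>R v + e"
      using y[OF n] by auto
    then show ?thesis
      by (intro bexI[of _ v]) simp_all
  qed
  have mem: "a \<in> B" if "closed B" "point_dist a B \<le> ennreal 0" for a :: 'a and B
    using point_dist_le_imp_ex[OF that(1) _ that(2)] by auto
  show "closed X0 \<Longrightarrow> y 0 \<in> X0"
    using y0 by (rule mem[rotated])
  show "n \<le> \<nu> \<Longrightarrow> closed (A (grid T N n)) \<Longrightarrow> y n \<in> A (grid T N n)"
    using yA by (rule mem[rotated])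
qed

text \<open>Every value is compared with the bounded set \<open>F 0 0\<close>; the time shift
  contributes at most \<open>L * T\<close>.\<close>

lemma lipschitz_field_linear_growth:
  fixes F :: "real \<Rightarrow> 'a::euclidean_space \<Rightarrow> 'a set"
  assumes F: "lipschitz_field T L F" and "L \<ge> 0" "T \<ge> 0"
  obtains g where "g \<ge> 0" "\<And>t x v. t \<in> {0..T} \<Longrightarrow> v \<in> F t x \<Longrightarrow> norm v \<le> g + L * norm x"
proof -
  have "bounded (F 0 0)"
    using F \<open>T \<ge> 0\<close> by (auto simp: lipschitz_field_def compact_imp_bounded)
  then obtain m where m: "m > 0" "\<And>v. v \<in> F 0 0 \<Longrightarrow> norm v \<le> m"
    by (auto simp: bounded_pos)
  have "norm v \<le> (m + L * T) + L * norm x" if t: "t \<in> {0..T}" and v: "v \<in> F t x" for t x v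
  proof -
    obtain b where b: "b \<in> F 0 0" "norm (v - b) \<le> L * \<bar>t - 0\<bar> + L * norm (x - 0)"
      using lipschitz_field_ex_near[OF F \<open>L \<ge> 0\<close> t _ v] \<open>T \<ge> 0\<close> by (metis atLeastAtMost_iff order.refl)
    have "L * t \<le> L * T"
      using t \<open>L \<ge> 0\<close> by (intro mult_left_mono) auto
    then show ?thesis
      using b m(2)[of b] t norm_triangle_ineq[of "v - b" b] by simp
  qed
  moreover have "m + L * T \<ge> 0"
    using m assms by simp
  ultimately show thesis
    using that by blast
qed

text \<open>The constant is fixed before \<open>N\<close>, \<open>b\<close>, \<open>\<tau>\<close>
  and \<open>y\<close>. The estimate covers all times of a cell, not only nodes, because (D1)
  involves the distance of the exact solution to \<open>A t\<close> at every
  \<open>t\<close>.\<close>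

lemma unconstrained_solution_near_discrete_solution:
  fixes F :: "real \<Rightarrow> 'a::euclidean_space \<Rightarrow> 'a set"
  assumes F: "lipschitz_field T L F" and "L > 0" "T > 0" "compact X0" "c \<ge> 0"
  obtains C where "C > 0"
    and "\<And>N b \<tau> y. N \<ge> 1 \<Longrightarrow> b \<le> c * (step T N)\<^sup>2 \<Longrightarrow> \<tau> \<in> {0<..T} \<Longrightarrow>
      y \<in> discrete_solutions T F A X0 N (nat \<lfloor>\<tau> / step T N\<rfloor>) b 0 \<Longrightarrow>
      \<exists>x\<in>unconstrained_solutions F X0 \<tau>. \<forall>n\<le>nat \<lfloor>\<tau> / step T N\<rfloor>. \<forall>t\<in>{0..\<tau>}.
        grid T N n \<le> t \<longrightarrow> t \<le> grid T N (Suc n) \<longrightarrow> norm (y n - x t) \<le> C * step T N"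
proof -
  obtain g where g: "g \<ge> 0" "\<And>t x v. t \<in> {0..T} \<Longrightarrow> v \<in> F t x \<Longrightarrow> norm v \<le> g + L * norm x"
    using lipschitz_field_linear_growth[OF F] \<open>L > 0\<close> \<open>T > 0\<close> by (metis less_imp_le)
  obtain B where B: "B > 0" "\<And>x. x \<in> X0 \<Longrightarrow> norm x \<le> B"
    using compact_imp_bounded[OF \<open>compact X0\<close>] by (auto simp: bounded_pos)
  \<comment> \<open>\<open>Y\<close> bounds the nodes by Gronwall and \<open>W\<close> the polygon
    speeds. \<open>E\<close> is the defect in the inclusion per unit of \<open>h\<close>:
    \<open>c\<close> from the blowup, \<open>L\<close> from freezing time, \<open>L * W\<close> from
    freezing the state. \<open>C\<close> adds the motion within one cell to the integrated Filippov
    error.\<close>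
  define Y where "Y = (B + (g + c * T) / L) * exp (L * T)"
  define W where "W = g + L * Y + c * T"
  define E where "E = c + L + L * W"
  define C where "C = W + T * (E * exp (L * T))"
  have "Y \<ge> 0"
    using assms g(1) B(1) by (simp add: Y_def)
  then have "W \<ge> 0"
    using assms g(1) by (simp add: W_def)
  then have "E > 0"
    using assms by (simp add: E_def add_pos_nonneg add_nonneg_pos)
  with \<open>W \<ge> 0\<close> have "C > 0"
    using \<open>T > 0\<close> by (simp add: C_def add_nonneg_pos)
  have "\<exists>x\<in>unconstrained_solutions F X0 \<tau>. \<forall>n\<le>nat \<lfloor>\<tau> / step T N\<rfloor>. \<forall>t\<in>{0..\<tau>}.
        grid T N n \<le> t \<longrightarrow> t \<le> grid T N (Suc n) \<longrightarrow> norm (y n - x t) \<le> C * step T N"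
    if N: "N \<ge> 1" and b: "b \<le> c * (step T N)\<^sup>2" and \<tau>: "\<tau> \<in> {0<..T}"
      and y: "y \<in> discrete_solutions T F A X0 N (nat \<lfloor>\<tau> / step T N\<rfloor>) b 0" for N b \<tau> y
  proof -
    define h where "h = step T N"
    define \<nu> where "\<nu> = nat \<lfloor>\<tau> / h\<rfloor>"
    have h: "h > 0" "h \<le> T"
      using N \<open>T > 0\<close> by (auto simp: h_def step_def field_simps)
    have grid: "grid T N n = real n * h" for n
      by (simp add: grid_def h_def)
    have \<nu>: "real \<nu> * h \<le> \<tau>" "\<tau> < real (Suc \<nu>) * h"
      unfolding \<nu>_def using \<tau> h by (intro nat_floor_divide_bounds; simp)+
    have grid_T: "real n * h \<in> {0..T}" if "n \<le> \<nu>" for n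
    proof -
      have "real n * h \<le> real \<nu> * h"
        using that h by (intro mult_right_mono) auto
      then have "real n * h \<le> T"
        using \<nu>(1) \<tau> by (meson greaterThanAtMost_iff order_trans)
      then show ?thesis
        using h by simp
    qed
    have ch: "c * h \<le> c * T"
      using h \<open>c \<ge> 0\<close> by (intro mult_left_mono)
    have y0: "y 0 \<in> X0"
      using discrete_solutionsD(2)[OF y] compact_imp_closed \<open>compact X0\<close> by blast
    \<comment> \<open>The value at \<open>\<nu>\<close> continues the polygon from the last grid point up to \<open>\<tau>\<close>.\<close>
    define u where "u n = (if n < \<nu> then (1 / h) *\<^sub>R (y (Suc n) - y n)
        else (SOME v. v \<in> F (real n * h) (y n)))" for n
    have y_Suc: "y (Suc n) = y n + h *\<^sub>R u n" if "n < \<nu>" for n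
      using that h by (simp add: u_def)
    have u_near: "\<exists>v\<in>F (real n * h) (y n). norm (u n - v) \<le> c * h" if n: "n \<le> \<nu>" for n
    proof (cases "n < \<nu>")
      case True
      then obtain v where v: "v \<in> F (real n * h) (y n)" "norm (y (Suc n) - y n - h *\<^sub>R v) \<le> b"
        using discrete_solutionsD(1)[OF y] by (auto simp: \<nu>_def h_def grid_def)
      have "y (Suc n) - y n - h *\<^sub>R v = h *\<^sub>R (u n - v)"
        using y_Suc[OF True] by (simp add: scaleR_diff_right)
      then have "h * norm (u n - v) \<le> b"
        using v(2) h(1) by simp
      \<comment> \<open>A blowup quadratic in \<open>h\<close> perturbs the position; divided by the
        step it perturbs the velocity by only \<open>c * h\<close>.\<close>
      also have "b \<le> h * (c * h)"
        using b by (simp add: h_def power2_eq_square mult_ac)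
      finally have "norm (u n - v) \<le> c * h"
        using h(1) by (rule mult_left_le_imp_le)
      then show ?thesis
        using v(1) by blast
    next
      case False
      have "F (real n * h) (y n) \<noteq> {}"
        using F grid_T[OF n] by (auto simp: lipschitz_field_def)
      then have "u n \<in> F (real n * h) (y n)"
        using False by (simp add: u_def some_in_eq)
      then show ?thesis
        using h \<open>c \<ge> 0\<close> by (intro bexI[of _ "u n"]) auto
    qed
    have u_growth: "norm (u n) \<le> (g + c * T) + L * norm (y n)" if n: "n \<le> \<nu>" for n
    proof -
      obtain v where v: "v \<in> F (real n * h) (y n)" "norm (u n - v) \<le> c * h"
        using u_near[OF n] by blast
      then show ?thesis
        using g(2)[OF grid_T[OF n] v(1)] ch norm_triangle_ineq[of "u n - v" v] by simp
    qed
    have y_bound: "norm (y n) \<le> Y" if n: "n \<le> \<nu>" for n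
      unfolding Y_def
    proof (rule discrete_gronwall[where h = h and \<nu> = \<nu>])
      fix n assume "n < \<nu>"
      then have "norm (y (Suc n)) \<le> norm (y n) + h * norm (u n)"
        using norm_triangle_ineq[of "y n" "h *\<^sub>R u n"] h(1) by (simp add: y_Suc)
      also have "\<dots> \<le> norm (y n) + h * (g + c * T + L * norm (y n))"
        using u_growth[of n] h(1) \<open>n < \<nu>\<close> by (intro add_left_mono mult_left_mono) auto
      finally show "norm (y (Suc n)) \<le> norm (y n) + h * (g + c * T + L * norm (y n))" .
    qed (use assms g B y0 h n grid_T[OF n] in auto)
    have u_bound: "norm (u n) \<le> W" if "n \<le> \<nu>" for n
      using u_growth[OF that] mult_left_mono[OF y_bound[OF that] less_imp_le[OF \<open>L > 0\<close>]]
      unfolding W_def by linarith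
    define w where "w t = u (nat \<lfloor>t / h\<rfloor>)" for t
    define S where "S = (\<lambda>n. real n * h) ` {..\<nu>}"
    have floor_le: "nat \<lfloor>t / h\<rfloor> \<le> \<nu>" if "t \<in> {0..\<tau>}" for t
      using that h unfolding \<nu>_def by (intro nat_mono floor_mono divide_right_mono) auto
    have w_cont: "continuous_on ({0..\<tau>} - S) w"
      unfolding w_def S_def by (rule continuous_on_euler_velocity[OF h(1) \<nu>(2)])
    have interp: "norm (y 0 + integral {0..t} w - y n) \<le> W * h"
      if n: "n \<le> \<nu>" and t: "real n * h \<le> t" "t \<le> real (Suc n) * h" for n t
    proof -
      have "integral {0..t} w = y n - y 0 + (t - real n * h) *\<^sub>R u n"
        unfolding w_def
        by (intro integral_unique has_integral_euler_velocity[where y = y and \<nu> = \<nu>] h(1) y_Suc n t)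
      moreover have "\<bar>t - real n * h\<bar> * norm (u n) \<le> h * W"
        using t h u_bound[OF n] by (intro mult_mono) (auto simp: algebra_simps)
      ultimately show ?thesis
        by (simp add: mult.commute)
    qed
    have near: "\<exists>v\<in>F t (y 0 + integral {0..t} w). norm (w t - v) \<le> E * h" if t: "t \<in> {0..\<tau>}" for t
    proof -
      define n where "n = nat \<lfloor>t / h\<rfloor>"
      have n: "n \<le> \<nu>"
        using floor_le[OF t] by (simp add: n_def)
      have tn: "real n * h \<le> t" "t < real (Suc n) * h"
        unfolding n_def using t h by (intro nat_floor_divide_bounds; simp)+
      obtain v where v: "v \<in> F (real n * h) (y n)" "norm (w t - v) \<le> c * h"
        using u_near[OF n] by (auto simp: w_def n_def)
      have "t \<in> {0..T}"
        using t \<tau> by auto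
      then obtain v' where v': "v' \<in> F t (y 0 + integral {0..t} w)"
        "norm (v - v') \<le> L * \<bar>real n * h - t\<bar> + L * norm (y n - (y 0 + integral {0..t} w))"
        using lipschitz_field_ex_near[OF F _ grid_T[OF n] _ v(1)] \<open>L > 0\<close> by (meson less_imp_le)
      have "L * \<bar>real n * h - t\<bar> \<le> L * h"
        using tn \<open>L > 0\<close> by (intro mult_left_mono) (auto simp: algebra_simps)
      moreover have "L * norm (y n - (y 0 + integral {0..t} w)) \<le> L * (W * h)"
        using interp[OF n tn(1)] tn(2) \<open>L > 0\<close> by (intro mult_left_mono) (auto simp: norm_minus_commute)
      moreover have "norm (w t - v') \<le> norm (w t - v) + norm (v - v')"
        using norm_triangle_ineq[of "w t - v" "v - v'"] by simp
      ultimately have "norm (w t - v') \<le> E * h"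
        using v(2) v'(2) by (simp add: E_def algebra_simps)
      then show ?thesis
        using v'(1) by blast
    qed
    have fin: "finite S"
      by (simp add: S_def)
    have w_bound: "norm (w t) \<le> W" if "t \<in> {0..\<tau>}" for t
      using u_bound floor_le[OF that] by (simp add: w_def)
    obtain v where v: "continuous_on ({0..\<tau>} - S) v"
      "\<And>t. t \<in> {0..\<tau>} \<Longrightarrow> v t \<in> F t (y 0 + integral {0..t} v)"
      "\<And>t. t \<in> {0..\<tau>} \<Longrightarrow> norm (v t - w t) \<le> E * h * exp (L * \<tau>)"
      using filippov_approximation[OF F \<open>L > 0\<close> _ _ fin w_cont w_bound near] \<tau> by auto
    define M where "M = E * h * exp (L * \<tau>) + W"
    have v_bound: "norm (v t) \<le> M" if "t \<in> {0..\<tau>}" for t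
      using v(3)[OF that] w_bound[OF that] norm_triangle_ineq[of "v t - w t" "w t"] by (simp add: M_def)
    have "M \<ge> 0"
      using \<open>E > 0\<close> \<open>W \<ge> 0\<close> h(1) by (simp add: M_def)
    have "(\<lambda>t. y 0 + integral {0..t} v) \<in> unconstrained_solutions F X0 \<tau>"
      by (intro unconstrained_solutions_integral[where S = S and M = M] fin v(1,2) v_bound \<open>M \<ge> 0\<close> y0)
    \<comment> \<open>The comparison passes through the polygon: \<open>interp\<close> costs
      \<open>W * h\<close>, and integrating the velocity difference over \<open>{0..t}\<close> costs
      at most \<open>T * (E * exp (L * T)) * h\<close>.\<close>
    moreover have "norm (y n - (y 0 + integral {0..t} v)) \<le> C * h"
      if n: "n \<le> \<nu>" and t: "t \<in> {0..\<tau>}" "real n * h \<le> t" "t \<le> real (Suc n) * h" for n t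
    proof -
      have v_int: "v integrable_on {0..\<tau>}"
        by (rule integrable_on_bounded_continuous_off_finite[OF fin v(1) v_bound])
      have w_int: "w integrable_on {0..\<tau>}"
        by (rule integrable_on_bounded_continuous_off_finite[OF fin w_cont w_bound])
      have const: "((\<lambda>_. E * h * exp (L * \<tau>)) has_integral t * (E * h * exp (L * \<tau>))) {0..t}"
        using t has_integral_const_real[of "E * h * exp (L * \<tau>)" 0 t] by simp
      have "norm (integral {0..t} v - integral {0..t} w) \<le> t * (E * h * exp (L * \<tau>))"
        by (rule norm_integral_diff_le[OF v_int w_int t(1) const v(3)])
      also have "\<dots> \<le> T * (E * h * exp (L * T))"
        using t \<tau> h \<open>E > 0\<close> \<open>L > 0\<close> by (intro mult_mono) auto
      finally have "norm (integral {0..t} v - integral {0..t} w) \<le> T * (E * exp (L * T)) * h"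
        by (simp add: mult_ac)
      then have "norm (y 0 + integral {0..t} w - y n) + norm (integral {0..t} v - integral {0..t} w) \<le> C * h"
        using interp[OF n t(2,3)] unfolding C_def distrib_right by linarith
      then have "norm (y 0 + integral {0..t} v - y n) \<le> C * h"
        using norm_triangle_ineq[of "y 0 + integral {0..t} w - y n" "integral {0..t} v - integral {0..t} w"]
        by (simp add: diff_add_eq)
      then show ?thesis
        by (subst norm_minus_commute)
    qed
    ultimately show ?thesis
      unfolding \<nu>_def[symmetric] h_def[symmetric] grid
      by (intro bexI[of _ "\<lambda>t. y 0 + integral {0..t} v"]) simp_all
  qed
  then show thesis
    using that \<open>C > 0\<close> by blast
qed

section \<open>From exact unconstrained trajectories to constrained ones\<close>

theorem proposition10:
  fixes T L P R :: real
    and F :: "real \<Rightarrow> real ^ 'd \<Rightarrow> (real ^ 'd) set"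
    and A :: "real \<Rightarrow> (real ^ 'd) set"
    and X0 :: "(real ^ 'd) set"
    and \<beta> :: "nat \<Rightarrow> real"
  assumes T_pos: "T > 0" and L_pos: "L > 0"
    and F: "lipschitz_field T L F"
    and A: "closed_constraint T A"
    and X0: "compact X0"
    and feasible: "\<exists>\<tau>\<in>{0<..T}. constrained_solutions F A X0 \<tau> \<noteq> {}"
    and D1: "\<forall>\<tau>\<in>{0<..max_time T F A X0}. \<exists>K>0.
      \<forall>xu\<in>unconstrained_solutions F X0 \<tau>. \<exists>xc\<in>constrained_solutions F A X0 \<tau>.
        (SUP t\<in>{0..\<tau>}. ennreal (norm (xu t - xc t)))
          \<le> ennreal K * (SUP t\<in>{0..\<tau>}. point_dist (xu t) (A t))"
    and D2: "\<exists>L_A>0. \<forall>t1\<in>{0..T}. \<forall>t2\<in>{0..T}.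
      set_excess (A t1) (A t2) \<le> ennreal (L_A * \<bar>t1 - t2\<bar>)"
    and \<beta>: "\<forall>N\<ge>1. \<beta> N = L * (P + 1) * (step T N)^2"
    and \<beta>_nonneg: "\<forall>N\<ge>1. \<beta> N \<ge> 0"
    and \<beta>_small: "(\<lambda>N. \<beta> N / step T N) \<longlonglongrightarrow> 0"
    and R: "R = bound_R T L F X0 \<beta> (\<lambda>_. 0)"
    and P: "P = bound_P T L F X0 R"
  shows "\<forall>\<tau>\<in>{0<..max_time T F A X0}. \<exists>C>0. \<forall>N\<ge>1.
    (SUP y\<in>discrete_solutions T F A X0 N (nat \<lfloor>\<tau> / step T N\<rfloor>) (\<beta> N) 0.
       INF x\<in>constrained_solutions F A X0 \<tau>.
         ennreal (MAX n\<in>{0..nat \<lfloor>\<tau> / step T N\<rfloor>}. norm (y n - x (grid T N n))))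
      \<le> ennreal (C * step T N)"
proof
  fix \<tau> assume \<tau>_max: "\<tau> \<in> {0<..max_time T F A X0}"
  \<comment> \<open>Feasibility makes the set of admissible times nonempty, so its real supremum is
    a genuine least upper bound.\<close>
  have "max_time T F A X0 \<le> T"
    unfolding max_time_def using feasible by (intro cSup_least) auto
  with \<tau>_max have \<tau>: "\<tau> \<in> {0<..T}"
    by auto
  obtain K where "K > 0" and K: "\<And>xu. xu \<in> unconstrained_solutions F X0 \<tau> \<Longrightarrow>
      \<exists>xc\<in>constrained_solutions F A X0 \<tau>. (SUP t\<in>{0..\<tau>}. ennreal (norm (xu t - xc t)))
        \<le> ennreal K * (SUP t\<in>{0..\<tau>}. point_dist (xu t) (A t))"
    using D1 \<tau>_max by blast
  obtain L_A where "L_A > 0" and L_A: "\<And>t1 t2. t1 \<in> {0..T} \<Longrightarrow> t2 \<in> {0..T} \<Longrightarrow>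
      set_excess (A t1) (A t2) \<le> ennreal (L_A * \<bar>t1 - t2\<bar>)"
    using D2 by blast
  have A_closed: "closed (A t)" if "t \<in> {0..T}" for t
    using A that by (auto simp: closed_constraint_def)
  have "step T 1 > 0"
    using T_pos by (simp add: step_def)
  \<comment> \<open>The sign of \<open>L * (P + 1)\<close> is read off from the blowup size at
    \<open>N = 1\<close>.\<close>
  moreover have "0 \<le> L * (P + 1) * (step T 1)\<^sup>2"
    using \<beta> \<beta>_nonneg by (metis order.refl)
  ultimately have c: "L * (P + 1) \<ge> 0"
    by (simp add: zero_le_mult_iff)
  obtain C where "C > 0" and C: "\<And>N b \<tau> y. N \<ge> 1 \<Longrightarrow> b \<le> L * (P + 1) * (step T N)\<^sup>2 \<Longrightarrow>
      \<tau> \<in> {0<..T} \<Longrightarrow> y \<in> discrete_solutions T F A X0 N (nat \<lfloor>\<tau> / step T N\<rfloor>) b 0 \<Longrightarrow>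
      \<exists>x\<in>unconstrained_solutions F X0 \<tau>. \<forall>n\<le>nat \<lfloor>\<tau> / step T N\<rfloor>. \<forall>t\<in>{0..\<tau>}.
        grid T N n \<le> t \<longrightarrow> t \<le> grid T N (Suc n) \<longrightarrow> norm (y n - x t) \<le> C * step T N"
    using unconstrained_solution_near_discrete_solution[OF F L_pos T_pos X0 c] by blast
  \<comment> \<open>\<open>C\<close> accounts for the passage from \<open>y\<close> to the
    unconstrained \<open>xu\<close>; \<open>K * (C + L_A)\<close> is (D1) applied to a violation of
    at most \<open>(C + L_A) * h\<close>.\<close>
  define C' where "C' = C + K * (C + L_A)"
  have "C' > 0"
    using \<open>C > 0\<close> \<open>K > 0\<close> \<open>L_A > 0\<close> by (simp add: C'_def add_pos_pos)
  moreover have "(INF x\<in>constrained_solutions F A X0 \<tau>.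
         ennreal (MAX n\<in>{0..nat \<lfloor>\<tau> / step T N\<rfloor>}. norm (y n - x (grid T N n)))) \<le> ennreal (C' * step T N)"
    if N: "N \<ge> 1" and y: "y \<in> discrete_solutions T F A X0 N (nat \<lfloor>\<tau> / step T N\<rfloor>) (\<beta> N) 0" for N y
  proof -
    define h where "h = step T N"
    define \<nu> where "\<nu> = nat \<lfloor>\<tau> / h\<rfloor>"
    have h: "h > 0"
      using N T_pos by (simp add: h_def step_def)
    have grid: "grid T N n = real n * h" for n
      by (simp add: grid_def h_def)
    have grid_\<tau>: "real n * h \<in> {0..\<tau>}" if "n \<le> \<nu>" for n
    proof -
      have "real n * h \<le> real \<nu> * h"
        using that h by (intro mult_right_mono) auto
      also have "\<dots> \<le> \<tau>"
        unfolding \<nu>_def using h \<tau> by (intro nat_floor_divide_bounds) auto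
      finally show ?thesis
        using h by simp
    qed
    have "\<beta> N \<le> L * (P + 1) * (step T N)\<^sup>2"
      using \<beta> N by simp
    from C[OF N this \<tau> y] obtain xu where xu: "xu \<in> unconstrained_solutions F X0 \<tau>"
      and xu_near: "\<And>n t. n \<le> \<nu> \<Longrightarrow> t \<in> {0..\<tau>} \<Longrightarrow> real n * h \<le> t \<Longrightarrow> t \<le> real (Suc n) * h \<Longrightarrow>
        norm (y n - xu t) \<le> C * h"
      unfolding grid h_def[symmetric] \<nu>_def[symmetric] by blast
    \<comment> \<open>The last node before \<open>t\<close> serves as intermediary:
      \<open>xu t\<close> is within \<open>C * h\<close> of \<open>y n\<close>, which satisfies the
      constraint at its own time, and (D2) moves that constraint to time \<open>t\<close> for
      \<open>L_A * h\<close>. The finite excess also shows that \<open>A t\<close> is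
      nonempty.\<close>
    have dist_A: "point_dist (xu t) (A t) \<le> ennreal ((C + L_A) * h)" if t: "t \<in> {0..\<tau>}" for t
    proof -
      define n where "n = nat \<lfloor>t / h\<rfloor>"
      have n: "n \<le> \<nu>"
        using t h unfolding n_def \<nu>_def by (intro nat_mono floor_mono divide_right_mono) auto
      have tn: "real n * h \<le> t" "t < real (Suc n) * h"
        unfolding n_def using t h by (intro nat_floor_divide_bounds; simp)+
      have in_T: "t \<in> {0..T}" "real n * h \<in> {0..T}"
        using t \<tau> grid_\<tau>[OF n] by auto
      have yA: "y n \<in> A (real n * h)"
        using discrete_solutionsD(3)[OF y, of n] n A_closed[OF in_T(2)] by (simp add: grid \<nu>_def h_def)
      have "point_dist (y n) (A t) \<le> set_excess (A (real n * h)) (A t)"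
        unfolding set_excess_def using yA by (rule SUP_upper)
      also have "\<dots> \<le> ennreal (L_A * \<bar>real n * h - t\<bar>)"
        using L_A in_T by blast
      also have "\<dots> \<le> ennreal (L_A * h)"
        using tn \<open>L_A > 0\<close> by (intro ennreal_leI mult_left_mono) (auto simp: algebra_simps)
      finally obtain a where a: "a \<in> A t" "norm (y n - a) \<le> L_A * h"
        using point_dist_le_imp_ex[OF A_closed[OF in_T(1)]] \<open>L_A > 0\<close> h
        by (meson less_imp_le mult_nonneg_nonneg)
      have "point_dist (xu t) (A t) \<le> ennreal (norm (xu t - a))"
        unfolding point_dist_def using a(1) by (rule INF_lower)
      also have "norm (xu t - a) \<le> C * h + L_A * h"
        using xu_near[OF n t tn(1)] tn(2) a(2) norm_triangle_ineq[of "xu t - y n" "y n - a"]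
        by (simp add: norm_minus_commute)
      finally show ?thesis
        by (simp add: distrib_right ennreal_leI)
    qed
    obtain xc where xc: "xc \<in> constrained_solutions F A X0 \<tau>"
      and xc_near: "(SUP t\<in>{0..\<tau>}. ennreal (norm (xu t - xc t)))
        \<le> ennreal K * (SUP t\<in>{0..\<tau>}. point_dist (xu t) (A t))"
      using K[OF xu] by blast
    have xc_bound: "norm (xu t - xc t) \<le> K * ((C + L_A) * h)" if t: "t \<in> {0..\<tau>}" for t
    proof -
      have "ennreal (norm (xu t - xc t)) \<le> (SUP t\<in>{0..\<tau>}. ennreal (norm (xu t - xc t)))"
        using t by (rule SUP_upper)
      also note xc_near
      also have "ennreal K * (SUP t\<in>{0..\<tau>}. point_dist (xu t) (A t)) \<le> ennreal K * ennreal ((C + L_A) * h)"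
        by (intro mult_left_mono SUP_least dist_A) auto
      also have "\<dots> = ennreal (K * ((C + L_A) * h))"
        using \<open>K > 0\<close> \<open>C > 0\<close> \<open>L_A > 0\<close> h by (simp add: ennreal_mult)
      finally show ?thesis
        using \<open>K > 0\<close> \<open>C > 0\<close> \<open>L_A > 0\<close> h by (subst (asm) ennreal_le_iff) auto
    qed
    have "norm (y n - xc (real n * h)) \<le> C' * h" if n: "n \<le> \<nu>" for n
    proof -
      have "norm (y n - xu (real n * h)) \<le> C * h"
        using h by (intro xu_near n grid_\<tau>[OF n] mult_right_mono) auto
      then show ?thesis
        using xc_bound[OF grid_\<tau>[OF n]]
          norm_triangle_ineq[of "y n - xu (real n * h)" "xu (real n * h) - xc (real n * h)"]
        by (simp add: C'_def algebra_simps)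
    qed
    then have "(MAX n\<in>{0..\<nu>}. norm (y n - xc (grid T N n))) \<le> C' * h"
      by (subst Max_le_iff) (auto simp: grid)
    then show ?thesis
      unfolding h_def[symmetric] \<nu>_def[symmetric] using xc by (intro INF_lower2[OF xc] ennreal_leI)
  qed
  ultimately show "\<exists>C>0. \<forall>N\<ge>1.
    (SUP y\<in>discrete_solutions T F A X0 N (nat \<lfloor>\<tau> / step T N\<rfloor>) (\<beta> N) 0.
       INF x\<in>constrained_solutions F A X0 \<tau>.
         ennreal (MAX n\<in>{0..nat \<lfloor>\<tau> / step T N\<rfloor>}. norm (y n - x (grid T N n))))
      \<le> ennreal (C * step T N)"
    by (intro exI[of _ C'] conjI allI impI SUP_least)
qed

end
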